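(* The Nash product rule is contribution incentive-compatible. That is: let $A$ be a finite set of projects, $N$ a finite set of agents with budgets $B_i>0$ and normalized utility functions $u_i\colon A\to\mathbb R_{\ge 0}$ ($i\in N$), and let $f$ be a mechanism with $f(C)\in\mathrm{NASH}(C)$ for every contribution profile $C$ (ties among maximizers being broken arbitrarily). Then for every $i\in N$, every profile $C=(C_{-i},C_i)$ and every $C_i'$ with $0\le C_i'\le C_i$, $$u_i(f(C_{-i},C_i'))-C_i'\;\le\;u_i(f(C_{-i},C_i))-C_i .$$
   Context: $A$ is a finite nonempty set of projects and $N$ a finite nonempty set of agents. For $V\ge 0$, $\Delta(V)$ is the set of functions $\delta\colon A\to\mathbb R_{\ge0}$ with $\sum_{x\in A}\delta(x)=V$ (distributions of value $V$). Each agent $i\in N$ has a budget $B_i>0$ and a utility function $u_i\colon A\to\mathbb R_{\ge0}$, which is not identically zero and is normalized so that $\min\{u_i(x)\colon x\in A, u_i(x)>0\}=1$. The utility of a distribution is $u_i(\delta)=\sum_{x\in A}\delta(x)u_i(x)$. A (contribution) profile is $C=(C_i)_{i\in N}$ with $C_i\in[0,B_i]$; $|C|=\sum_{i\in N}C_i$. A mechanism $f$ maps every profile $C$ to a distribution $f(C)\in\Delta(|C|)$ (utilities and budgets are fixed). $(C_{-i},C_i')$ denotes the profile obtained from $C$ by replacing agent $i$'s contribution by $C_i'$. The Nash product rule is $$\mathrm{NASH}(C)=\arg\max_{\delta\in\Delta(|C|)}\prod_{i\in N}u_i(\delta)^{C_i}=\arg\max_{\delta\in\Delta(|C|)}\sum_{i\in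 N}C_i\log(u_i(\delta)),$$ with the conventions $0^0=1$, $0\log 0=0$ (and $\log 0=-\infty$ when the coefficient is positive), so agents with zero contribution are ignored. *)

theory Defs
  imports "HOL-Analysis.Analysis"
begin

(* Distributions and profiles are extensional functions: they take the value undefined
   outside A and N respectively, so that they correspond exactly to functions on A and N. *)

definition distributions :: "'a set \<Rightarrow> real \<Rightarrow> ('a \<Rightarrow> real) set" where
  "distributions A V = {\<delta> \<in> A \<rightarrow>\<^sub>E {0..}. (\<Sum>x\<in>A. \<delta> x) = V}"

definition profiles :: "'i set \<Rightarrow> ('i \<Rightarrow> real) \<Rightarrow> ('i \<Rightarrow> real) set" where
  "profiles N B = (\<Pi>\<^sub>E i\<in>N. {0..B i})"

definition normalized_utility :: "'a set \<Rightarrow> ('a \<Rightarrow> real) \<Rightarrow> bool" where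
  "normalized_utility A v \<longleftrightarrow>
     (\<forall>x\<in>A. 0 \<le> v x) \<and> (\<exists>x\<in>A. v x \<noteq> 0) \<and> Min {v x |x. x \<in> A \<and> 0 < v x} = 1"

definition utility :: "'a set \<Rightarrow> ('a \<Rightarrow> real) \<Rightarrow> ('a \<Rightarrow> real) \<Rightarrow> real" where
  "utility A v \<delta> = (\<Sum>x\<in>A. \<delta> x * v x)"

definition mechanism ::
  "'a set \<Rightarrow> 'i set \<Rightarrow> ('i \<Rightarrow> real) \<Rightarrow> (('i \<Rightarrow> real) \<Rightarrow> 'a \<Rightarrow> real) \<Rightarrow> bool" where
  "mechanism A N B f \<longleftrightarrow> (\<forall>C\<in>profiles N B. f C \<in> distributions A (\<Sum>i\<in>N. C i))"

(* The library sets 0 powr 0 = 0, whereas the Nash product uses the convention 0^0 = 1. *)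
definition nash_power :: "real \<Rightarrow> real \<Rightarrow> real" where
  "nash_power x c = (if c = 0 then 1 else x powr c)"

definition nash_product ::
  "'a set \<Rightarrow> 'i set \<Rightarrow> ('i \<Rightarrow> 'a \<Rightarrow> real) \<Rightarrow> ('i \<Rightarrow> real) \<Rightarrow> ('a \<Rightarrow> real) \<Rightarrow> real" where
  "nash_product A N u C \<delta> = (\<Prod>i\<in>N. nash_power (utility A (u i) \<delta>) (C i))"

definition nash ::
  "'a set \<Rightarrow> 'i set \<Rightarrow> ('i \<Rightarrow> 'a \<Rightarrow> real) \<Rightarrow> ('i \<Rightarrow> real) \<Rightarrow> ('a \<Rightarrow> real) set" where
  "nash A N u C =
     {\<delta>. is_arg_max (nash_product A N u C) (\<lambda>\<delta>. \<delta> \<in> distributions A (\<Sum>i\<in>N. C i)) \<delta>}"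

definition contribution_incentive_compatible ::
  "'a set \<Rightarrow> 'i set \<Rightarrow> ('i \<Rightarrow> real) \<Rightarrow> ('i \<Rightarrow> 'a \<Rightarrow> real) \<Rightarrow>
     (('i \<Rightarrow> real) \<Rightarrow> 'a \<Rightarrow> real) \<Rightarrow> bool" where
  "contribution_incentive_compatible A N B u f \<longleftrightarrow>
     (\<forall>i\<in>N. \<forall>C\<in>profiles N B. \<forall>c. 0 \<le> c \<and> c \<le> C i \<longrightarrow>
        utility A (u i) (f (C(i := c))) - c \<le> utility A (u i) (f C) - C i)"

(* The logarithmic form of the Nash product rule, with 0 * log 0 = 0 and log 0 = -infinity
   for a positive coefficient, has the same maximizers. *)

definition nash_log :: "real \<Rightarrow> real \<Rightarrow> ereal" where
  "nash_log x c = (if c = 0 then 0 else if x = 0 then - \<infinity> else ereal (c * ln x))"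

lemma nash_power_nonneg: "0 \<le> nash_power x c"
  by (simp add: nash_power_def)

lemma sum_nash_log:
  assumes "finite N" "\<And>i. i \<in> N \<Longrightarrow> 0 \<le> x i"
  shows "(\<Sum>i\<in>N. nash_log (x i) (c i)) =
    (if (\<Prod>i\<in>N. nash_power (x i) (c i)) = 0 then - \<infinity>
     else ereal (ln (\<Prod>i\<in>N. nash_power (x i) (c i))))"
  using assms
proof (induction N rule: finite_induct)
  case empty
  then show ?case by (simp add: zero_ereal_def)
next
  case (insert j M)
  have "0 \<le> (\<Prod>i\<in>M. nash_power (x i) (c i))"
    by (intro prod_nonneg) (simp add: nash_power_nonneg)
  moreover have "0 \<le> x j"
    using insert.prems by simp
  ultimately show ?case
    using insert by (auto simp: nash_log_def nash_power_def ln_mult ln_powr)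
qed

lemma nash_eq_arg_max_log:
  assumes "finite N" "\<And>i x. i \<in> N \<Longrightarrow> x \<in> A \<Longrightarrow> 0 \<le> u i x"
  shows "nash A N u C =
    {\<delta>. is_arg_max (\<lambda>\<delta>. \<Sum>i\<in>N. nash_log (utility A (u i) \<delta>) (C i))
          (\<lambda>\<delta>. \<delta> \<in> distributions A (\<Sum>i\<in>N. C i)) \<delta>}"
proof -
  have eq: "(\<Sum>i\<in>N. nash_log (utility A (u i) \<delta>) (C i)) =
      (if nash_product A N u C \<delta> = 0 then - \<infinity> else ereal (ln (nash_product A N u C \<delta>)))"
    if "\<delta> \<in> distributions A (\<Sum>i\<in>N. C i)" for \<delta>
    unfolding nash_product_def
  proof (rule sum_nash_log)
    show "0 \<le> utility A (u i) \<delta>" if "i \<in> N" for i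
      using that assms(2) \<open>\<delta> \<in> _\<close>
      by (auto simp: utility_def distributions_def intro!: sum_nonneg mult_nonneg_nonneg)
  qed (use assms in simp)
  have nonneg: "0 \<le> nash_product A N u C \<delta>" for \<delta>
    by (simp add: nash_product_def prod_nonneg nash_power_nonneg)
  have "(\<Sum>i\<in>N. nash_log (utility A (u i) \<delta>) (C i)) <
        (\<Sum>i\<in>N. nash_log (utility A (u i) \<epsilon>) (C i)) \<longleftrightarrow>
      nash_product A N u C \<delta> < nash_product A N u C \<epsilon>"
    if "\<delta> \<in> distributions A (\<Sum>i\<in>N. C i)" "\<epsilon> \<in> distributions A (\<Sum>i\<in>N. C i)" for \<delta> \<epsilon>
    using nonneg[of \<delta>] nonneg[of \<epsilon>] by (auto simp: eq that)
  then show ?thesis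
    unfolding nash_def is_arg_max_def by blast
qed

end

(* Let delta and delta' be the Nash outcomes for C and C' = C(i := c).  The first-order conditions say
   that the price sum_j C_j u_j(x) / u_j(delta) of every project x is at most 1, with equality on the
   support of delta; likewise for C' and delta'.  Let z be the restriction of delta' to the projects that
   i values.  Evaluating the price systems at delta, delta' and z, and combining the results by
   Cauchy-Schwarz over the other agents, gives C_i - c <= (u_i(delta) / u_i(delta') - 1) |z|.
   Normalization enters only through |z| <= u_i(delta').  If u_i(delta') = 0, the equality case
   of the first-order conditions for delta already gives C_i <= u_i(delta). *)
theory Submission
  imports Defs
begin

section \<open>Basic facts on utilities, distributions and the Nash product\<close>

lemma utility_nonneg:
  assumes "\<And>x. x \<in> A \<Longrightarrow> 0 \<le> v x" "\<And>x. x \<in> A \<Longrightarrow> 0 \<le> \<delta> x"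
  shows "0 \<le> utility A v \<delta>"
  unfolding utility_def using assms by (intro sum_nonneg mult_nonneg_nonneg) auto

lemma distributions_nonneg: "\<delta> \<in> distributions A V \<Longrightarrow> x \<in> A \<Longrightarrow> 0 \<le> \<delta> x"
  by (auto simp: distributions_def)

lemma distributions_sum: "\<delta> \<in> distributions A V \<Longrightarrow> sum \<delta> A = V"
  by (auto simp: distributions_def)

lemma normalized_utility_ge_one:
  assumes "finite A" "normalized_utility A v" "x \<in> A" "0 < v x"
  shows "1 \<le> v x"
proof -
  have "finite {v x |x. x \<in> A \<and> 0 < v x}"
    using assms(1) by simp
  then have "Min {v x |x. x \<in> A \<and> 0 < v x} \<le> v x"
    by (rule Min_le) (use assms in auto)
  then show ?thesis
    using assms(2) by (simp add: normalized_utility_def)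
qed

lemma nash_product_nonneg: "0 \<le> nash_product A N u C \<delta>"
  by (simp add: nash_product_def prod_nonneg nash_power_nonneg)

lemma nash_product_pos_iff:
  assumes "finite N" "\<And>j. j \<in> N \<Longrightarrow> 0 \<le> utility A (u j) \<delta>"
  shows "0 < nash_product A N u C \<delta> \<longleftrightarrow> (\<forall>j\<in>N. C j \<noteq> 0 \<longrightarrow> 0 < utility A (u j) \<delta>)"
proof -
  have "0 < nash_product A N u C \<delta> \<longleftrightarrow> nash_product A N u C \<delta> \<noteq> 0"
    using nash_product_nonneg[of A N u C \<delta>] by auto
  also have "\<dots> \<longleftrightarrow> (\<forall>j\<in>N. C j \<noteq> 0 \<longrightarrow> utility A (u j) \<delta> \<noteq> 0)"
    using assms(1) by (auto simp: nash_product_def nash_power_def)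
  also have "\<dots> \<longleftrightarrow> (\<forall>j\<in>N. C j \<noteq> 0 \<longrightarrow> 0 < utility A (u j) \<delta>)"
    using assms(2) by (auto simp: less_le)
  finally show ?thesis .
qed

text \<open>Passing to a sum of logarithms allows termwise differentiation. Positivity is asked of
  contributing agents only: a zero contribution gives a factor 1 in the product and a summand 0 in
  the exponent, whatever the utility.\<close>

lemma nash_product_eq_exp:
  assumes "finite N" "\<And>j. j \<in> N \<Longrightarrow> 0 \<le> C j"
    and pos: "\<And>j. j \<in> N \<Longrightarrow> 0 < C j \<Longrightarrow> 0 < utility A (u j) \<delta>"
  shows "nash_product A N u C \<delta> = exp (\<Sum>j\<in>N. C j * ln (utility A (u j) \<delta>))"
proof -
  have "nash_power (utility A (u j) \<delta>) (C j) = exp (C j * ln (utility A (u j) \<delta>))" if "j \<in> N" for j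
  proof (cases "C j = 0")
    case False
    then have "0 < utility A (u j) \<delta>"
      using assms(2)[OF that] pos[OF that] by simp
    with False show ?thesis by (simp add: nash_power_def powr_def)
  qed (simp add: nash_power_def)
  then show ?thesis
    by (simp add: nash_product_def exp_sum assms(1))
qed

section \<open>First-order conditions for Nash outcomes\<close>

text \<open>Budgets are left out, so that a profile and its modification in one contribution are
  both instances.\<close>

locale contributions =
  fixes A :: "'a set" and N :: "'i set" and u :: "'i \<Rightarrow> 'a \<Rightarrow> real" and C :: "'i \<Rightarrow> real"
  assumes fin_A: "finite A" and ne_A: "A \<noteq> {}" and fin_N: "finite N"
    and u_nonneg: "j \<in> N \<Longrightarrow> x \<in> A \<Longrightarrow> 0 \<le> u j x"
    and u_nonzero: "j \<in> N \<Longrightarrow> \<exists>x\<in>A. u j x \<noteq> 0"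
    and C_nonneg: "j \<in> N \<Longrightarrow> 0 \<le> C j"
begin

lemma nash_in_distributions: "\<delta> \<in> nash A N u C \<Longrightarrow> \<delta> \<in> distributions A (sum C N)"
  by (auto simp: nash_def is_arg_max_def)

lemma nash_product_le_nash:
  "\<delta> \<in> nash A N u C \<Longrightarrow> \<epsilon> \<in> distributions A (sum C N) \<Longrightarrow>
    nash_product A N u C \<epsilon> \<le> nash_product A N u C \<delta>"
  by (auto simp: nash_def is_arg_max_def not_less)

lemma distributions_utility_nonneg:
  "\<delta> \<in> distributions A V \<Longrightarrow> j \<in> N \<Longrightarrow> 0 \<le> utility A (u j) \<delta>"
  by (auto intro: utility_nonneg u_nonneg distributions_nonneg)

text \<open>The uniform distribution serves as competitor: every agent values some project, so its
  Nash product is positive, and hence so is that of a maximizer.\<close>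

lemma nash_utility_pos:
  assumes "\<delta> \<in> nash A N u C" "j \<in> N" "0 < C j"
  shows "0 < utility A (u j) \<delta>"
proof -
  define V where "V = sum C N"
  define \<epsilon> where "\<epsilon> = (\<lambda>x\<in>A. V / card A)"
  have "C j \<le> V"
    unfolding V_def by (rule member_le_sum) (auto intro: C_nonneg assms fin_N)
  with assms have "0 < V" by simp
  have card: "0 < card A"
    using fin_A ne_A by (simp add: card_gt_0_iff)
  have \<epsilon>: "\<epsilon> \<in> distributions A V"
    using \<open>0 < V\<close> card by (auto simp: \<epsilon>_def distributions_def)
  have "0 < utility A (u k) \<epsilon>" if "k \<in> N" for k
  proof -
    obtain x where x: "x \<in> A" "u k x \<noteq> 0"
      using u_nonzero \<open>k \<in> N\<close> by blast
    show ?thesis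
      unfolding utility_def
    proof (rule sum_pos2[OF fin_A \<open>x \<in> A\<close>])
      show "0 < \<epsilon> x * u k x"
        using x u_nonneg[OF \<open>k \<in> N\<close> \<open>x \<in> A\<close>] \<open>0 < V\<close> card by (auto simp: \<epsilon>_def)
      show "0 \<le> \<epsilon> y * u k y" if "y \<in> A" for y
        using that u_nonneg[OF \<open>k \<in> N\<close>] \<open>0 < V\<close> by (auto simp: \<epsilon>_def)
    qed
  qed
  then have "0 < nash_product A N u C \<epsilon>"
    by (subst nash_product_pos_iff) (auto simp: fin_N less_imp_le)
  also have "\<dots> \<le> nash_product A N u C \<delta>"
    using nash_product_le_nash assms(1) \<epsilon> V_def by blast
  finally have "\<forall>j\<in>N. C j \<noteq> 0 \<longrightarrow> 0 < utility A (u j) \<delta>"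
    using distributions_utility_nonneg[OF nash_in_distributions[OF assms(1)]]
    by (subst (asm) nash_product_pos_iff) (auto simp: fin_N)
  with assms show ?thesis by auto
qed

text \<open>Moving from \<open>\<delta>\<close> towards \<open>\<epsilon>\<close> cannot raise the
  logarithmic objective \<open>g\<close> above its value at 0, so the derivative of \<open>g\<close>
  at 0 is at most 0.\<close>

lemma nash_gradient:
  assumes \<delta>: "\<delta> \<in> nash A N u C" and \<epsilon>: "\<epsilon> \<in> distributions A (sum C N)"
  shows "(\<Sum>j\<in>N. C j * (utility A (u j) \<epsilon> / utility A (u j) \<delta>)) \<le> sum C N"
proof -
  define a where "a j = utility A (u j) \<delta>" for j
  define e where "e j = utility A (u j) \<epsilon>" for j
  define g where "g t = (\<Sum>j\<in>N. C j * ln (a j + t * (e j - a j)))" for t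
  note \<delta>' = nash_in_distributions[OF \<delta>]
  have a_pos: "0 < a j" if "j \<in> N" "0 < C j" for j
    using nash_utility_pos[OF \<delta>] that by (simp add: a_def)
  have e_nonneg: "0 \<le> e j" if "j \<in> N" for j
    using distributions_utility_nonneg[OF \<epsilon> that] by (simp add: e_def)
  have le: "g t \<le> g 0" if t: "0 < t" "t < 1" for t
  proof -
    define \<eta> where "\<eta> = (\<lambda>x\<in>A. \<delta> x + t * (\<epsilon> x - \<delta> x))"
    have "0 \<le> \<eta> x" if "x \<in> A" for x
    proof -
      have "\<eta> x = (1 - t) * \<delta> x + t * \<epsilon> x"
        using that by (simp add: \<eta>_def algebra_simps)
      then show ?thesis
        using t distributions_nonneg[OF \<delta>' that] distributions_nonneg[OF \<epsilon> that] by simp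
    qed
    moreover have "sum \<eta> A = sum C N"
      using distributions_sum[OF \<delta>'] distributions_sum[OF \<epsilon>]
      by (simp add: \<eta>_def sum.distrib sum_subtractf flip: sum_distrib_left)
    ultimately have "\<eta> \<in> distributions A (sum C N)"
      by (auto simp: distributions_def \<eta>_def)
    then have "nash_product A N u C \<eta> \<le> nash_product A N u C \<delta>"
      by (rule nash_product_le_nash[OF \<delta>])
    moreover have util: "utility A (u j) \<eta> = a j + t * (e j - a j)" for j
      by (simp add: utility_def \<eta>_def a_def e_def algebra_simps sum.distrib sum_subtractf
          sum_distrib_left)
    moreover have "0 < a j + t * (e j - a j)" if "j \<in> N" "0 < C j" for j
    proof -
      have "0 < (1 - t) * a j + t * e j"
        using t a_pos[OF that] e_nonneg[OF \<open>j \<in> N\<close>] by (intro add_pos_nonneg) auto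
      then show ?thesis by (simp add: algebra_simps)
    qed
    ultimately show ?thesis
      using a_pos C_nonneg fin_N by (simp add: nash_product_eq_exp g_def util flip: a_def)
  qed
  have "DERIV g 0 :> (\<Sum>j\<in>N. C j * ((e j - a j) / a j))"
    unfolding g_def
  proof (rule DERIV_sum)
    show "DERIV (\<lambda>t. C j * ln (a j + t * (e j - a j))) 0 :> C j * ((e j - a j) / a j)"
      if "j \<in> N" for j
    \<comment> \<open>If \<open>C j = 0\<close>, then \<open>a j\<close> may be 0, where the
      logarithm has no derivative; but the summand is constantly 0.\<close>
    proof (cases "C j = 0")
      case False
      then have "0 < a j" using a_pos C_nonneg that by (simp add: less_le)
      then show ?thesis by (auto intro!: derivative_eq_intros)
    qed simp
  qed
  moreover have "\<not> (\<exists>d>0. \<forall>h>0. h < d \<longrightarrow> g 0 < g (0 + h))"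
  proof
    assume "\<exists>d>0. \<forall>h>0. h < d \<longrightarrow> g 0 < g (0 + h)"
    then obtain d where "0 < d" "\<And>h. 0 < h \<Longrightarrow> h < d \<Longrightarrow> g 0 < g h" by auto
    moreover define h where "h = min d 1 / 2"
    ultimately have "0 < h" "h < d" "h < 1" "g 0 < g h" by auto
    with le[of h] show False by simp
  qed
  ultimately have "(\<Sum>j\<in>N. C j * ((e j - a j) / a j)) \<le> 0"
    using DERIV_pos_inc_right by (meson not_le)
  moreover have "C j * ((e j - a j) / a j) = C j * (e j / a j) - C j" if "j \<in> N" for j
    using a_pos[OF that] C_nonneg[OF that] by (cases "C j = 0") (auto simp: field_simps)
  ultimately show ?thesis
    by (simp add: sum_subtractf flip: a_def e_def)
qed

text \<open>\<open>nash_gradient\<close> is applied to the distribution that spends everything on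
  \<open>x\<close>; the factor \<open>sum C N\<close> then cancels. If the total is 0, all
  contributions vanish.\<close>

lemma nash_price_le_one:
  assumes \<delta>: "\<delta> \<in> nash A N u C" and x: "x \<in> A"
  shows "(\<Sum>j\<in>N. C j * (u j x / utility A (u j) \<delta>)) \<le> 1"
proof (cases "sum C N = 0")
  case True
  then have "\<forall>j\<in>N. C j = 0"
    by (subst (asm) sum_nonneg_eq_0_iff) (auto simp: fin_N C_nonneg)
  then show ?thesis by simp
next
  case False
  define \<epsilon> where "\<epsilon> = (\<lambda>y\<in>A. if y = x then sum C N else 0)"
  have V: "0 < sum C N"
    using False sum_nonneg[of N C] C_nonneg by (simp add: less_le)
  then have "\<epsilon> \<in> distributions A (sum C N)"
    using fin_A x by (auto simp: \<epsilon>_def distributions_def)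
  moreover have "utility A (u j) \<epsilon> = sum C N * u j x" for j
    using fin_A x by (simp add: utility_def \<epsilon>_def if_distrib[of "\<lambda>a. a * _"] cong: if_cong)
  ultimately have "(\<Sum>j\<in>N. C j * (sum C N * u j x / utility A (u j) \<delta>)) \<le> sum C N"
    using nash_gradient[OF \<delta>, of \<epsilon>] by (simp only:)
  moreover have "(\<Sum>j\<in>N. C j * (sum C N * u j x / utility A (u j) \<delta>)) =
      sum C N * (\<Sum>j\<in>N. C j * (u j x / utility A (u j) \<delta>))"
    by (simp add: sum_distrib_left mult_ac)
  ultimately show ?thesis
    using V by simp
qed

text \<open>Exchange of summation: the cost of a bundle \<open>w\<close> is counted by agents on the
  left and by projects on the right.\<close>

lemma sum_price:
  "(\<Sum>j\<in>N. C j * (utility A (u j) w / a j)) = (\<Sum>x\<in>A. w x * (\<Sum>j\<in>N. C j * (u j x / a j)))"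
proof -
  have "(\<Sum>j\<in>N. C j * (utility A (u j) w / a j)) = (\<Sum>j\<in>N. \<Sum>x\<in>A. w x * (C j * (u j x / a j)))"
    by (simp add: utility_def sum_divide_distrib sum_distrib_left mult_ac)
  also have "\<dots> = (\<Sum>x\<in>A. \<Sum>j\<in>N. w x * (C j * (u j x / a j)))"
    by (rule sum.swap)
  finally show ?thesis by (simp add: sum_distrib_left)
qed

text \<open>In contrast to \<open>nash_gradient\<close>, \<open>w\<close> may have any total. This
  allows pricing outcomes of other profiles and restrictions of outcomes.\<close>

lemma nash_cost_le:
  assumes "\<delta> \<in> nash A N u C" "\<And>x. x \<in> A \<Longrightarrow> 0 \<le> w x"
  shows "(\<Sum>j\<in>N. C j * (utility A (u j) w / utility A (u j) \<delta>)) \<le> sum w A"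
  unfolding sum_price
  using assms by (intro sum_mono mult_left_le nash_price_le_one)

text \<open>Complementary slackness: at its own prices \<open>\<delta>\<close> costs exactly its
  total, so the nonnegative terms \<open>\<delta> y * (1 - p y)\<close> add up to 0 and each of them
  vanishes.\<close>

lemma nash_price_eq_one:
  assumes \<delta>: "\<delta> \<in> nash A N u C" and x: "x \<in> A" "\<delta> x \<noteq> 0"
  shows "(\<Sum>j\<in>N. C j * (u j x / utility A (u j) \<delta>)) = 1"
proof -
  define p where "p x = (\<Sum>j\<in>N. C j * (u j x / utility A (u j) \<delta>))" for x
  note \<delta>' = nash_in_distributions[OF \<delta>]
  have "C j * (utility A (u j) \<delta> / utility A (u j) \<delta>) = C j" if "j \<in> N" for j
    using nash_utility_pos[OF \<delta> that] C_nonneg[OF that] by (cases "C j = 0") auto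
  then have "sum C N = (\<Sum>j\<in>N. C j * (utility A (u j) \<delta> / utility A (u j) \<delta>))"
    by (intro sum.cong) auto
  also have "\<dots> = (\<Sum>y\<in>A. \<delta> y * p y)"
    unfolding p_def by (rule sum_price)
  finally have "(\<Sum>y\<in>A. \<delta> y * (1 - p y)) = 0"
    using distributions_sum[OF \<delta>'] by (simp add: right_diff_distrib sum_subtractf)
  moreover have "0 \<le> \<delta> y * (1 - p y)" if "y \<in> A" for y
    using nash_price_le_one[OF \<delta> that] distributions_nonneg[OF \<delta>' that] by (simp add: p_def)
  ultimately have "\<delta> x * (1 - p x) = 0"
    using x(1) by (simp only: sum_nonneg_eq_0_iff[OF fin_A])
  with x show ?thesis by (simp add: p_def)
qed

lemma nash_cost_eq:
  assumes "\<delta> \<in> nash A N u C" "\<And>x. x \<in> A \<Longrightarrow> \<delta> x = 0 \<Longrightarrow> w x = 0"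
  shows "(\<Sum>j\<in>N. C j * (utility A (u j) w / utility A (u j) \<delta>)) = sum w A"
  unfolding sum_price
proof (rule sum.cong[OF refl])
  show "w x * (\<Sum>j\<in>N. C j * (u j x / utility A (u j) \<delta>)) = w x" if "x \<in> A" for x
    using assms(2)[OF that] nash_price_eq_one[OF assms(1) that] by (cases "\<delta> x = 0") auto
qed

end

section \<open>Real inequalities for the comparison of two outcomes\<close>

text \<open>Cauchy-Schwarz for one agent, linearized with a free parameter \<open>k\<close>.\<close>
lemma price_change_le:
  fixes a b c k :: real
  assumes "0 < a" "0 < b" "0 \<le> c" "c \<le> b"
  shows "2 * k * (c / b - c / a) \<le> a / b + b / a - 2 + k\<^sup>2 * (c / a)"
proof -
  \<comment> \<open>Clearing denominators in the claim leaves this square plus a remainder, which is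
    nonnegative because \<open>c \<le> b\<close>.\<close>
  have "0 \<le> (a - b - k * c)\<^sup>2 + k\<^sup>2 * (c * (b - c))"
    using assms by simp
  also have "\<dots> = a * b * (a / b + b / a - 2 + k\<^sup>2 * (c / a) - 2 * k * (c / b - c / a))"
    using assms(1,2) by (simp add: field_simps power2_eq_square)
  finally have "a * b * 0 \<le> a * b * (a / b + b / a - 2 + k\<^sup>2 * (c / a) - 2 * k * (c / b - c / a))"
    by simp
  then have "0 \<le> a / b + b / a - 2 + k\<^sup>2 * (c / a) - 2 * k * (c / b - c / a)"
    by (rule mult_left_le_imp_le) (use assms(1,2) in simp)
  then show ?thesis by simp
qed

text \<open>Here \<open>x\<close> and \<open>y\<close> stand for the utilities of the agent before
  and after the reduction, \<open>p\<close> and \<open>q\<close> for the two contributions and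
  \<open>Z\<close> for the mass of the restricted outcome. One choice of \<open>k\<close> excludes
  \<open>x \<le> y\<close>, another gives the bound.\<close>

lemma contribution_le_of_quadratic:
  fixes p q x y Z :: real
  assumes "0 < x" "0 < y" "0 \<le> q" "q < p" "Z \<le> y" "p * (y / x) \<le> Z"
    and quad: "\<And>k. 0 \<le> k \<Longrightarrow>
      2 * k * (p * (y / x) - q) \<le> p + q - p * (y / x) - q * (x / y) + k\<^sup>2 * (Z - p * (y / x))"
  shows "p - q \<le> x - y"
proof -
  define r where "r = x / y"
  define E where "E = p - q * r"
  define T where "T = r * Z - p"
  have r: "0 < r" "y / x = 1 / r" "x / y = r" "x = r * y"
    using assms(1,2) by (auto simp: r_def)
  have T: "0 \<le> T"
    using assms(6) r(1) unfolding T_def r(2) by (simp add: field_simps)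
  \<comment> \<open>Multiplying by \<open>r\<close> clears the quotients, and the terms free of
    \<open>k\<close> factor as \<open>E * (r - 1)\<close>.\<close>
  have quad': "2 * k * E \<le> E * (r - 1) + k\<^sup>2 * T" if "0 \<le> k" for k
  proof -
    have "r * (2 * k * (p * (1 / r) - q)) \<le>
        r * (p + q - p * (1 / r) - q * r + k\<^sup>2 * (Z - p * (1 / r)))"
      using quad[OF that] r by (intro mult_left_mono) auto
    moreover have "r * (2 * k * (p * (1 / r) - q)) = 2 * k * E"
      using r(1) by (simp add: E_def field_simps)
    moreover have "r * (p + q - p * (1 / r) - q * r + k\<^sup>2 * (Z - p * (1 / r))) = E * (r - 1) + k\<^sup>2 * T"
      using r(1) by (simp add: E_def T_def field_simps)
    ultimately show ?thesis by (simp only:)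
  qed
  have "1 < r"
  proof (rule ccontr)
    assume "\<not> 1 < r"
    then have "q * r \<le> q"
      using assms(3) by (simp add: mult_left_le)
    then have E: "0 < E"
      using assms(4) by (simp add: E_def)
    \<comment> \<open>For \<open>r \<le> 1\<close> the term free of \<open>k\<close> is at most 0,
      and for this small \<open>k\<close> the linear term exceeds the quadratic one. The denominator
      \<open>T + 1\<close> stays positive when \<open>T = 0\<close>.\<close>
    have "2 * (E / (T + 1)) * E \<le> E * (r - 1) + (E / (T + 1))\<^sup>2 * T"
      using E T by (intro quad') simp
    also have "\<dots> \<le> (E / (T + 1))\<^sup>2 * T"
      using E \<open>\<not> 1 < r\<close> by (simp add: mult_le_0_iff)
    also have "\<dots> \<le> (E / (T + 1))\<^sup>2 * (T + 1)"
      by (intro mult_left_mono) auto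
    also have "\<dots> = E / (T + 1) * E"
      using T by (simp add: power2_eq_square)
    finally have "E / (T + 1) * E \<le> 0" by simp
    moreover have "0 < E / (T + 1) * E" using E T by simp
    ultimately show False by simp
  qed
  \<comment> \<open>The choice \<open>k = r - 1\<close> makes every term divisible by
    \<open>r - 1\<close>. What remains, \<open>E \<le> (r - 1) * T\<close>, rearranges to
    \<open>r * (p - q) \<le> r * ((r - 1) * Z)\<close>.\<close>
  have "(r - 1) * (2 * E) \<le> (r - 1) * (E + (r - 1) * T)"
    using quad'[of "r - 1"] \<open>1 < r\<close> by (simp add: power2_eq_square algebra_simps)
  then have "2 * E \<le> E + (r - 1) * T"
    using \<open>1 < r\<close> by simp
  then have "r * (p - q) \<le> r * ((r - 1) * Z)"
    by (simp add: E_def T_def algebra_simps)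
  then have "p - q \<le> (r - 1) * Z"
    using r(1) by simp
  also have "\<dots> \<le> (r - 1) * y"
    using \<open>1 < r\<close> assms(5) by simp
  also have "\<dots> = x - y"
    using r(4) by (simp add: algebra_simps)
  finally show ?thesis .
qed

section \<open>Comparison of the outcomes before and after a reduced contribution\<close>

lemma nash_contribution:
  fixes A :: "'a set" and N :: "'i set"
  assumes "contributions A N u C" and i: "i \<in> N" and norm: "normalized_utility A (u i)"
    and c: "0 \<le> c" "c < C i"
    and \<delta>: "\<delta> \<in> nash A N u C" and \<delta>': "\<delta>' \<in> nash A N u (C(i := c))"
  shows "C i - c \<le> utility A (u i) \<delta> - utility A (u i) \<delta>'"
proof -
  interpret contributions A N u C by fact
  interpret C': contributions A N u "C(i := c)"
    by unfold_locales (use fin_A ne_A fin_N u_nonneg u_nonzero C_nonneg c in auto)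
  define a where "a j = utility A (u j) \<delta>" for j
  define b where "b j = utility A (u j) \<delta>'" for j
  note D = nash_in_distributions[OF \<delta>] and D' = C'.nash_in_distributions[OF \<delta>']
  \<comment> \<open>Dropping the projects worthless to \<open>i\<close> keeps the utility of
    \<open>i\<close>; each unit left yields utility at least 1, so the mass is at most that
    utility.\<close>
  define liked where "liked \<epsilon> x = (if 0 < u i x then \<epsilon> x else 0)" for \<epsilon> :: "'a \<Rightarrow> real" and x
  have liked: "sum (liked \<epsilon>) A \<le> utility A (u i) \<epsilon>" "utility A (u i) (liked \<epsilon>) = utility A (u i) \<epsilon>"
    if \<epsilon>: "\<And>x. x \<in> A \<Longrightarrow> 0 \<le> \<epsilon> x" for \<epsilon>
  proof -
    show "sum (liked \<epsilon>) A \<le> utility A (u i) \<epsilon>"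
      unfolding utility_def
    proof (rule sum_mono)
      show "liked \<epsilon> x \<le> \<epsilon> x * u i x" if "x \<in> A" for x
      proof (cases "0 < u i x")
        case True
        then have "\<epsilon> x * 1 \<le> \<epsilon> x * u i x"
          using \<epsilon> that normalized_utility_ge_one[OF fin_A norm that] by (intro mult_left_mono) auto
        with True show ?thesis by (simp add: liked_def)
      next
        case False
        with \<epsilon> that u_nonneg[OF i that] show ?thesis by (simp add: liked_def)
      qed
    qed
    show "utility A (u i) (liked \<epsilon>) = utility A (u i) \<epsilon>"
      unfolding utility_def using u_nonneg[OF i] by (intro sum.cong) (force simp: liked_def)+
  qed
  have a_pos: "0 < a j" if "j \<in> N" "0 < C j" for j
    using nash_utility_pos[OF \<delta> that] by (simp add: a_def)
  have ai: "0 < a i" using a_pos i c by simp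
  show ?thesis
  \<comment> \<open>\<open>b i = 0\<close> can occur only for \<open>c = 0\<close>. Then
    \<open>liked \<delta>\<close>, priced by \<open>\<delta>\<close>, suffices: the share of
    \<open>i\<close> alone is \<open>C i\<close>, and the whole cost is a mass of at most
    \<open>a i\<close>.\<close>
  proof (cases "b i = 0")
    case True
    define d where "d j = utility A (u j) (liked \<delta>)" for j
    have "C i = C i * (d i / a i)"
      using ai liked(2) distributions_nonneg[OF D] by (simp add: d_def a_def)
    also have "\<dots> \<le> (\<Sum>j\<in>N. C j * (d j / a j))"
    proof (rule member_le_sum[OF i _ fin_N])
      show "0 \<le> C j * (d j / a j)" if "j \<in> N - {i}" for j
        using that C_nonneg distributions_nonneg[OF D] u_nonneg
        unfolding a_def d_def
        by (intro mult_nonneg_nonneg divide_nonneg_nonneg utility_nonneg) (auto simp: liked_def)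
    qed
    also have "\<dots> = sum (liked \<delta>) A"
      unfolding a_def d_def by (rule nash_cost_eq[OF \<delta>]) (simp add: liked_def)
    also have "\<dots> \<le> a i"
      unfolding a_def by (rule liked) (rule distributions_nonneg[OF D])
    finally show ?thesis
      using True c(1) by (simp flip: a_def b_def)
  next
    case False
    then have bi: "0 < b i"
      using C'.distributions_utility_nonneg[OF D' i] by (simp add: b_def less_le)
    \<comment> \<open>For \<open>i\<close> itself positivity comes from the case distinction, since
      \<open>c\<close> may be 0.\<close>
    have b_pos: "0 < b j" if "j \<in> N" "0 < C j" for j
      using C'.nash_utility_pos[OF \<delta>' that(1)] that bi by (cases "j = i") (auto simp: b_def)
    define z where "z = liked \<delta>'"
    define s where "s j = utility A (u j) z" for j
    define M where "M = N - {i}"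
    have z_nonneg: "0 \<le> z x" if "x \<in> A" for x
      using distributions_nonneg[OF D' that] by (simp add: z_def liked_def)
    have si: "s i = b i"
      using liked(2) distributions_nonneg[OF D'] by (simp add: s_def b_def z_def)
    have s_nonneg: "0 \<le> s j" if "j \<in> N" for j
      unfolding s_def by (intro utility_nonneg u_nonneg z_nonneg that)
    have s_le: "s j \<le> b j" if "j \<in> N" for j
      unfolding s_def b_def utility_def
      using that by (intro sum_mono mult_right_mono)
        (auto simp: z_def liked_def intro: u_nonneg distributions_nonneg[OF D'])
    have split: "sum h N = h i + sum h M" for h :: "'i \<Rightarrow> real"
      using sum.remove[OF fin_N i] by (simp add: M_def)
    have upd: "(\<Sum>j\<in>M. (C(i := c)) j * h j) = (\<Sum>j\<in>M. C j * h j)" for h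
      by (rule sum.cong) (auto simp: M_def)
    have sumC': "sum (C(i := c)) N = c + sum C M"
      using upd[of "\<lambda>_. 1"] by (simp add: split)
    \<comment> \<open>The bundle \<open>z\<close> is priced by both outcomes, then each outcome by
      the other. The second evaluation is an equality because \<open>z\<close> vanishes wherever
      \<open>\<delta>'\<close> does.\<close>
    have 1: "C i * (b i / a i) + (\<Sum>j\<in>M. C j * (s j / a j)) \<le> sum z A"
      using nash_cost_le[OF \<delta>, of z, OF z_nonneg]
      by (simp only: split si flip: a_def s_def)
    have 2: "c + (\<Sum>j\<in>M. C j * (s j / b j)) = sum z A"
    proof -
      have "c * (b i / b i) + (\<Sum>j\<in>M. C j * (s j / b j)) = sum z A"
        using C'.nash_cost_eq[OF \<delta>', of z]
        by (simp only: split upd si fun_upd_same flip: b_def s_def) (simp add: z_def liked_def)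
      with bi show ?thesis by simp
    qed
    have 3: "C i * (b i / a i) + (\<Sum>j\<in>M. C j * (b j / a j)) \<le> c + sum C M"
      using nash_cost_le[OF \<delta>, of \<delta>', OF distributions_nonneg[OF D']]
      unfolding distributions_sum[OF D'] sumC' by (simp only: split flip: a_def b_def)
    have 4: "c * (a i / b i) + (\<Sum>j\<in>M. C j * (a j / b j)) \<le> C i + sum C M"
      using C'.nash_cost_le[OF \<delta>', of \<delta>, OF distributions_nonneg[OF D]]
      unfolding distributions_sum[OF D] by (simp only: split upd fun_upd_same flip: a_def b_def)
    have "C i - c \<le> a i - b i"
    proof (rule contribution_le_of_quadratic[OF ai bi c])
      show "sum z A \<le> b i"
        unfolding z_def b_def by (rule liked) (rule distributions_nonneg[OF D'])
      have "0 \<le> (\<Sum>j\<in>M. C j * (s j / a j))"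
        using C_nonneg s_nonneg distributions_utility_nonneg[OF D]
        by (intro sum_nonneg mult_nonneg_nonneg divide_nonneg_nonneg) (auto simp: M_def a_def)
      with 1 show "C i * (b i / a i) \<le> sum z A" by simp
    next
      fix k :: real assume "0 \<le> k"
      have "(\<Sum>j\<in>M. C j * (2 * k * (s j / b j - s j / a j))) \<le>
          (\<Sum>j\<in>M. C j * (a j / b j + b j / a j - 2 + k\<^sup>2 * (s j / a j)))"
      proof (rule sum_mono)
        show "C j * (2 * k * (s j / b j - s j / a j)) \<le>
            C j * (a j / b j + b j / a j - 2 + k\<^sup>2 * (s j / a j))" if "j \<in> M" for j
        \<comment> \<open>Without a contribution, \<open>a j\<close> or \<open>b j\<close> may be 0
          and \<open>price_change_le\<close> does not apply; the weight removes such agents.\<close>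
        proof (cases "C j = 0")
          case False
          have "j \<in> N" using that by (simp add: M_def)
          with False have "0 < C j" using C_nonneg by (simp add: less_le)
          with \<open>j \<in> N\<close> show ?thesis
            by (intro mult_left_mono price_change_le) (auto intro: a_pos b_pos s_nonneg s_le)
        qed simp
      qed
      then have "2 * k * ((\<Sum>j\<in>M. C j * (s j / b j)) - (\<Sum>j\<in>M. C j * (s j / a j))) \<le>
          (\<Sum>j\<in>M. C j * (a j / b j)) + (\<Sum>j\<in>M. C j * (b j / a j)) - 2 * sum C M
          + k\<^sup>2 * (\<Sum>j\<in>M. C j * (s j / a j))"
        by (simp add: sum.distrib sum_subtractf sum_distrib_left sum_distrib_right
            algebra_simps)
      \<comment> \<open>Subtracting \<open>1\<close> from \<open>2\<close> bounds from below the
        change in the other agents' part of the cost of \<open>z\<close>; \<open>k \<ge> 0\<close>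
        preserves the direction. Next, \<open>1\<close> bounds the quadratic term, and finally
        \<open>3\<close> plus \<open>4\<close> bounds the terms free of \<open>k\<close>.\<close>
      moreover have "2 * k * (C i * (b i / a i) - c) \<le>
          2 * k * ((\<Sum>j\<in>M. C j * (s j / b j)) - (\<Sum>j\<in>M. C j * (s j / a j)))"
        using 1 2 \<open>0 \<le> k\<close> by (intro mult_left_mono) auto
      moreover have "k\<^sup>2 * (\<Sum>j\<in>M. C j * (s j / a j)) \<le> k\<^sup>2 * (sum z A - C i * (b i / a i))"
        using 1 by (intro mult_left_mono) auto
      ultimately show "2 * k * (C i * (b i / a i) - c) \<le>
          C i + c - C i * (b i / a i) - c * (a i / b i) + k\<^sup>2 * (sum z A - C i * (b i / a i))"
        using 3 4 by linarith
    qed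
    then show ?thesis by (simp add: a_def b_def)
  qed
qed

theorem theorem3:
  fixes A :: "'a set" and N :: "'i set"
    and B :: "'i \<Rightarrow> real" and u :: "'i \<Rightarrow> 'a \<Rightarrow> real"
    and f :: "('i \<Rightarrow> real) \<Rightarrow> 'a \<Rightarrow> real"
  assumes "finite A" "A \<noteq> {}" "finite N" "N \<noteq> {}"
    and "\<forall>i\<in>N. 0 < B i"
    and "\<forall>i\<in>N. normalized_utility A (u i)"
    and "mechanism A N B f"
    and "\<forall>C\<in>profiles N B. f C \<in> nash A N u C"
  shows "contribution_incentive_compatible A N B u f"
  unfolding contribution_incentive_compatible_def
proof (intro ballI allI impI)
  fix i C c
  assume i: "i \<in> N" and C: "C \<in> profiles N B" and c: "0 \<le> c \<and> c \<le> C i"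
  show "utility A (u i) (f (C(i := c))) - c \<le> utility A (u i) (f C) - C i"
  \<comment> \<open>For \<open>c = C i\<close> the profile is unchanged, and \<open>f\<close>
    selects the same outcome even if there are several maximizers. Otherwise \<open>c < C i\<close>,
    as \<open>nash_contribution\<close> requires.\<close>
  proof (cases "c = C i")
    case False
    have bounds: "0 \<le> C j \<and> C j \<le> B j" if "j \<in> N" for j
      using C that by (auto simp: profiles_def)
    have "C(i := c) \<in> profiles N B"
      using C c i bounds[OF i] by (auto simp: profiles_def PiE_def extensional_def)
    moreover have "contributions A N u C"
      by unfold_locales (use assms bounds in \<open>auto simp: normalized_utility_def\<close>)
    ultimately have "C i - c \<le> utility A (u i) (f C) - utility A (u i) (f (C(i := c)))"
      using assms C i c False by (intro nash_contribution) auto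
    then show ?thesis by simp
  qed simp
qed

end
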